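(* For the Kneser graph $K(n,k)$, $\operatorname{lbox}(K(n,k))\le \frac{k}{2}\log\log n$.
   Context: All graphs are finite, simple and undirected. The Kneser graph $K(n,k)$ is the graph whose vertices are the $k$-element subsets of $\{1,\dots,n\}$, two of them being adjacent if and only if they are disjoint. An interval graph is a graph whose vertices can be mapped to closed intervals of the real line so that two distinct vertices are adjacent if and only if their intervals intersect. For graphs $G, I_1,\dots,I_r$ on the same vertex set, $G=\bigcap_{i=1}^r I_i$ means $E(G)=E(I_1)\cap\cdots\cap E(I_r)$. A vertex is universal in a graph if it is adjacent to all other vertices of that graph, and non-universal otherwise. The local boxicity $\operatorname{lbox}(G)$ is the smallest positive integer $l$ such that, for some $r$, $G=\bigcap_{i=1}^r I_i$ where each $I_i$ is an interval graph on $V(G)$ and each vertex of $G$ is a non-universal vertex in at most $l$ of the graphs $I_1,\dots,I_r$. Logarithms are to base $2$.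
   Formalization: The formal theorem assumes k ≥ 1 and n ≥ 16; without a lower bound on n the inequality fails, e.g. for k = 1 and 2 ≤ n ≤ 15 the right-hand side is below 1 while lbox is at least 1, and k = 0 makes it 0. *)

theory Defs
  imports Complex_Main "Graph_Theory.Pair_Digraph"
begin

text \<open>
  A finite simple undirected graph is a \<open>pair_graph\<close>: a finite vertex set with an irreflexive,
  symmetric set of arcs, an edge \<open>uv\<close> being represented by the two arcs \<open>(u, v)\<close> and \<open>(v, u)\<close>.
\<close>

definition kneser_graph :: "nat \<Rightarrow> nat \<Rightarrow> nat set pair_pre_digraph" where
  "kneser_graph n k =
     \<lparr> pverts = {A. A \<subseteq> {1..n} \<and> card A = k},
       parcs = {(A, B). A \<subseteq> {1..n} \<and> card A = k \<and> B \<subseteq> {1..n} \<and> card B = k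
                        \<and> A \<noteq> B \<and> A \<inter> B = {}} \<rparr>"

text \<open>The condition \<open>A \<noteq> B\<close> only matters for \<open>k = 0\<close>, where it prevents a loop at the empty set.\<close>

lemma pair_graph_kneser_graph: "pair_graph (kneser_graph n k)"
proof
  show "finite (pverts (kneser_graph n k))"
    by (rule finite_subset[of _ "Pow {1..n}"]) (auto simp: kneser_graph_def)
  show "finite (parcs (kneser_graph n k))"
    by (rule finite_subset[of _ "Pow {1..n} \<times> Pow {1..n}"]) (auto simp: kneser_graph_def)
  show "symmetric (with_proj (kneser_graph n k))"
    unfolding symmetric_def by (rule symI) (auto simp: kneser_graph_def)
  fix e assume "e \<in> parcs (kneser_graph n k)"
  then show "fst e \<in> pverts (kneser_graph n k)" "snd e \<in> pverts (kneser_graph n k)" "fst e \<noteq> snd e"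
    by (cases e; simp add: kneser_graph_def)+
qed

definition interval_graph :: "'a pair_pre_digraph \<Rightarrow> bool" where
  "interval_graph G \<longleftrightarrow> pair_graph G \<and>
     (\<exists>a b :: 'a \<Rightarrow> real.
        (\<forall>v \<in> pverts G. a v \<le> b v) \<and>
        (\<forall>u \<in> pverts G. \<forall>v \<in> pverts G. u \<noteq> v \<longrightarrow>
           (u \<rightarrow>\<^bsub>G\<^esub> v \<longleftrightarrow> {a u..b u} \<inter> {a v..b v} \<noteq> {})))"

definition universal_vertex :: "'a pair_pre_digraph \<Rightarrow> 'a \<Rightarrow> bool" where
  "universal_vertex G v \<longleftrightarrow> v \<in> pverts G \<and> (\<forall>u \<in> pverts G. u \<noteq> v \<longrightarrow> v \<rightarrow>\<^bsub>G\<^esub> u)"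

text \<open>
  At least one graph is required so that the intersection of the edge sets is meaningful. This
  excludes no graph: the complete graph is an interval graph in which every vertex is universal.
\<close>

definition local_interval_representation ::
  "'a pair_pre_digraph \<Rightarrow> nat \<Rightarrow> (nat \<Rightarrow> 'a pair_pre_digraph) \<Rightarrow> nat \<Rightarrow> bool" where
  "local_interval_representation G r I l \<longleftrightarrow>
     1 \<le> r \<and>
     (\<forall>i \<in> {1..r}. interval_graph (I i) \<and> pverts (I i) = pverts G) \<and>
     parcs G = (\<Inter>i \<in> {1..r}. parcs (I i)) \<and>
     (\<forall>v \<in> pverts G. card {i \<in> {1..r}. \<not> universal_vertex (I i) v} \<le> l)"

definition lbox :: "'a pair_pre_digraph \<Rightarrow> nat" where
  "lbox G = (LEAST l. 1 \<le> l \<and> (\<exists>r I. local_interval_representation G r I l))"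

end

theory Submission
  imports Defs
begin

text \<open>
  For each \<open>i \<in> {1..n}\<close>, let \<open>I\<^sub>i\<close> join two vertices unless both contain \<open>i\<close>. Mapping the
  vertices containing \<open>i\<close> to distinct points and the others to one long interval shows that \<open>I\<^sub>i\<close> is
  an interval graph, and only the vertices containing \<open>i\<close> can be non-universal in it. Hence
  the local boxicity is at most \<open>k\<close>, while \<open>n \<ge> 16\<close> gives \<open>log log n \<ge> 2\<close>.
\<close>

definition star_graph :: "'a set set \<Rightarrow> 'a \<Rightarrow> 'a set pair_pre_digraph" where
  "star_graph V i =
     \<lparr> pverts = V, parcs = {(A, B). A \<in> V \<and> B \<in> V \<and> A \<noteq> B \<and> \<not> (i \<in> A \<and> i \<in> B)} \<rparr>"

lemma pverts_star_graph [simp]: "pverts (star_graph V i) = V"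
  by (simp add: star_graph_def)

lemma pair_graph_star_graph:
  assumes "finite V"
  shows "pair_graph (star_graph V i)"
proof
  show "finite (pverts (star_graph V i))"
    using assms by simp
  show "finite (parcs (star_graph V i))"
    by (rule finite_subset[of _ "V \<times> V"]) (auto simp: star_graph_def assms)
  show "symmetric (with_proj (star_graph V i))"
    unfolding symmetric_def by (rule symI) (auto simp: star_graph_def)
  fix e assume "e \<in> parcs (star_graph V i)"
  then show "fst e \<in> pverts (star_graph V i)" "snd e \<in> pverts (star_graph V i)" "fst e \<noteq> snd e"
    by (cases e; simp add: star_graph_def)+
qed

text \<open>The members of \<open>V\<close> containing \<open>i\<close>, the star of
  \<open>i\<close> in the language of set families, become pairwise disjoint points. All other
  members share one interval covering these points, so they meet everything.\<close>

lemma interval_graph_star_graph: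
  fixes V :: "'a set set"
  assumes "finite V"
  shows "interval_graph (star_graph V i)"
proof -
  \<comment> \<open>An injective numbering supplies the distinct points; all of them lie in the
    interval from \<open>0\<close> to \<open>N\<close>.\<close>
  obtain f :: "'a set \<Rightarrow> nat" and N where f: "f ` V = {j. j < N}" "inj_on f V"
    using finite_imp_inj_to_nat_seg[OF assms] by blast
  define a where "a A = (if i \<in> A then real (f A) else 0)" for A
  define b where "b A = (if i \<in> A then real (f A) else real N)" for A
  have less: "f A < N" if "A \<in> V" for A
    using f(1) that by blast
  have "a A \<le> b A" for A
    by (simp add: a_def b_def)
  moreover have "A \<rightarrow>\<^bsub>star_graph V i\<^esub> B \<longleftrightarrow> {a A..b A} \<inter> {a B..b B} \<noteq> {}"
    if "A \<in> V" "B \<in> V" "A \<noteq> B" for A B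
    using that less[of A] less[of B] inj_onD[OF f(2), of A B]
    by (auto simp: star_graph_def a_def b_def)
  ultimately show ?thesis
    using pair_graph_star_graph[OF assms, of i]
    unfolding interval_graph_def pverts_star_graph by blast
qed

text \<open>Two sets are disjoint exactly when no single \<open>i\<close> lies in both, so each
  ground element contributes one graph, and a vertex is charged only for its own \<open>k\<close>
  elements.\<close>

lemma local_interval_representation_kneser_graph:
  assumes "1 \<le> n"
  shows "local_interval_representation (kneser_graph n k) n
           (star_graph (pverts (kneser_graph n k))) k"
proof -
  define V where "V = pverts (kneser_graph n k)"
  have V: "A \<in> V \<longleftrightarrow> A \<subseteq> {1..n} \<and> card A = k" for A
    by (simp add: V_def kneser_graph_def)
  have "finite V"
    using V by (intro finite_subset[of V "Pow {1..n}"]) blast+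
  have "parcs (kneser_graph n k) = (\<Inter>i \<in> {1..n}. parcs (star_graph V i))"
  proof (intro set_eqI)
    fix e :: "nat set \<times> nat set"
    obtain A B where e: "e = (A, B)" by fastforce
    have "e \<in> parcs (kneser_graph n k) \<longleftrightarrow> A \<in> V \<and> B \<in> V \<and> A \<noteq> B \<and> A \<inter> B = {}"
      by (auto simp: e kneser_graph_def V)
    also have "\<dots> \<longleftrightarrow> A \<in> V \<and> B \<in> V \<and> A \<noteq> B \<and> (\<forall>i \<in> {1..n}. \<not> (i \<in> A \<and> i \<in> B))"
      unfolding V by blast
    also have "\<dots> \<longleftrightarrow> e \<in> (\<Inter>i \<in> {1..n}. parcs (star_graph V i))"
      \<comment> \<open>Since \<open>1 \<le> n\<close>, the index set is nonempty; an empty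
        intersection would be the set of all pairs.\<close>
      using assms by (auto simp: e star_graph_def)
    finally show "e \<in> parcs (kneser_graph n k) \<longleftrightarrow> e \<in> (\<Inter>i \<in> {1..n}. parcs (star_graph V i))" .
  qed
  moreover have "card {i \<in> {1..n}. \<not> universal_vertex (star_graph V i) A} \<le> k" if "A \<in> V" for A
  proof -
    have "{i \<in> {1..n}. \<not> universal_vertex (star_graph V i) A} \<subseteq> A"
      using that by (auto simp: universal_vertex_def star_graph_def)
    moreover have "finite A"
      using that V finite_subset by blast
    ultimately show ?thesis
      using that V card_mono by metis
  qed
  ultimately show ?thesis
    using assms interval_graph_star_graph[OF \<open>finite V\<close>]
    unfolding local_interval_representation_def V_def[symmetric]
    by simp
qed

theorem corollary21:
  fixes n k :: nat
  assumes "1 \<le> k" and "16 \<le> n"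
  shows "real (lbox (kneser_graph n k)) \<le> real k / 2 * log 2 (log 2 (real n))"
proof -
  have "lbox (kneser_graph n k) \<le> k"
    unfolding lbox_def
    \<comment> \<open>Positivity of the candidate \<open>k\<close>, required in \<open>lbox\<close>,
      is the assumption \<open>1 \<le> k\<close>.\<close>
    using assms local_interval_representation_kneser_graph[of n k] by (intro Least_le) auto
  \<comment> \<open>The value 2 cancels the factor 1/2 of the bound, and 16 is 2 to the power
    2^2.\<close>
  moreover have "2 \<le> log 2 (log 2 (real n))"
  proof -
    have "2 powr 4 \<le> real n"
      using assms(2) by simp
    then have "4 \<le> log 2 (real n)"
      using assms(2) by (subst le_log_iff) auto
    then show ?thesis
      by (subst le_log_iff) auto
  qed
  then have "real k \<le> real k / 2 * log 2 (log 2 (real n))"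
    using mult_left_mono[of 2 "log 2 (log 2 (real n))" "real k / 2"] by simp
  ultimately show ?thesis
    by linarith
qed

end
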